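(* Let $\mathrm{LB}$ be the objective-function value of a feasible solution of CMESP, and let $(\hat\Theta,\hat\upsilon,\hat\nu,\hat\pi,\hat\tau)$ be a feasible solution of DFact with objective-function value $\hat\zeta$. Then every optimal solution $x^*$ of CMESP satisfies $$x_j^*=0\ \text{ for all } j\in N \text{ such that } \hat\zeta-\mathrm{LB}<\hat\upsilon_j,$$ $$x_j^*=1\ \text{ for all } j\in N \text{ such that } \hat\zeta-\mathrm{LB}<\hat\nu_j.$$
   Context: Let $n>1$, $0<s<n$ be integers, $N:=\{1,\dots,n\}$, let $C$ be a real symmetric positive semidefinite $n\times n$ matrix of rank $r\ge s$, and let $A\in\mathbb{R}^{m\times n}$, $b\in\mathbb{R}^m$. Let $C=FF^\top$ with $F\in\mathbb{R}^{n\times k}$, $r\le k\le n$. For a symmetric matrix $M$, $\lambda_\ell(M)$ is its $\ell$-th greatest eigenvalue (with multiplicity); $\operatorname{diag}(M)$ is the vector of diagonal entries of $M$; $\mathbf{e}$ is the all-ones vector; vector inequalities are componentwise. $\operatorname{ldet}$ denotes the natural logarithm of the determinant (equal to $-\infty$ for a singular positive semidefinite matrix). For $x\in\{0,1\}^n$, $S(x)$ is its support, and $C[S,S]$ is the principal submatrix of $C$ indexed by $S$. CMESP is the problem $$\max\{\operatorname{ldet}C[S(x),S(x)] : \mathbf{e}^\top x=s,\ Ax\le b,\ x\in\{0,1\}^n\}.$$ DFact is the problem: minimize $$f(\Theta,\nu,\pi,\tau):=-\sum_{\ell=k-s+1}^{k}\log\lambda_\ell(\Theta)+\nu^\top\mathbf{e}+\pi^\top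 b+\tau s-s$$ over symmetric $\Theta\in\mathbb{R}^{k\times k}$, $\upsilon,\nu\in\mathbb{R}^n$, $\pi\in\mathbb{R}^m$, $\tau\in\mathbb{R}$, subject to $$\operatorname{diag}(F\Theta F^\top)+\upsilon-\nu-A^\top\pi-\tau\mathbf{e}=0,\qquad \Theta\succ0,\ \upsilon\ge0,\ \nu\ge0,\ \pi\ge0 .$$ *)

theory Defs
  imports
    "HOL-Library.Extended_Real"
    "Jordan_Normal_Form.Char_Poly"
    "Jordan_Normal_Form.DL_Rank"
    "Jordan_Normal_Form.DL_Submatrix"
begin

text \<open>Vectors and matrices are those of Jordan_Normal_Form, so indices start at 0: the index set
  N = {1,...,n} of the mathematical text is rendered as {..<n}. The order on vectors is
  the componentwise one.\<close>

definition psd_mat :: "nat \<Rightarrow> real mat \<Rightarrow> bool" where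
  "psd_mat n M \<longleftrightarrow> M \<in> carrier_mat n n \<and> transpose_mat M = M \<and>
     (\<forall>x \<in> carrier_vec n. 0 \<le> x \<bullet> (M *\<^sub>v x))"

definition pd_mat :: "nat \<Rightarrow> real mat \<Rightarrow> bool" where
  "pd_mat n M \<longleftrightarrow> M \<in> carrier_mat n n \<and> transpose_mat M = M \<and>
     (\<forall>x \<in> carrier_vec n. x \<noteq> 0\<^sub>v n \<longrightarrow> 0 < x \<bullet> (M *\<^sub>v x))"

text \<open>The l-th greatest eigenvalue, l = 1, 2, ..., of a real symmetric matrix. All roots of its
  characteristic polynomial are real, so the multiset of real roots lists every eigenvalue with
  its multiplicity.\<close>

definition nth_greatest_eigenvalue :: "nat \<Rightarrow> real mat \<Rightarrow> real" where
  "nth_greatest_eigenvalue l M = rev (sorted_list_of_multiset (proots (char_poly M))) ! (l - 1)"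

text \<open>Only used for positive semidefinite matrices, whose determinant is nonnegative.\<close>

definition ldet :: "real mat \<Rightarrow> ereal" where
  "ldet M = (if det M = 0 then -\<infinity> else ereal (ln (det M)))"

definition ones_vec :: "nat \<Rightarrow> real vec" where
  "ones_vec n = vec n (\<lambda>_. 1)"

definition diag_vec :: "real mat \<Rightarrow> real vec" where
  "diag_vec M = vec_of_list (diag_mat M)"

definition support_vec :: "real vec \<Rightarrow> nat set" where
  "support_vec x = {i. i < dim_vec x \<and> x $ i \<noteq> 0}"

definition CMESP_feasible ::
  "nat \<Rightarrow> nat \<Rightarrow> real mat \<Rightarrow> real vec \<Rightarrow> real vec \<Rightarrow> bool" where
  "CMESP_feasible n s A b x \<longleftrightarrow>
     x \<in> carrier_vec n \<and> (\<forall>i < n. x $ i \<in> {0, 1}) \<and>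
     ones_vec n \<bullet> x = real s \<and> A *\<^sub>v x \<le> b"

definition CMESP_objective :: "real mat \<Rightarrow> real vec \<Rightarrow> ereal" where
  "CMESP_objective C x = ldet (submatrix C (support_vec x) (support_vec x))"

definition CMESP_optimal ::
  "nat \<Rightarrow> nat \<Rightarrow> real mat \<Rightarrow> real mat \<Rightarrow> real vec \<Rightarrow> real vec \<Rightarrow> bool" where
  "CMESP_optimal n s C A b x \<longleftrightarrow>
     CMESP_feasible n s A b x \<and>
     (\<forall>y. CMESP_feasible n s A b y \<longrightarrow> CMESP_objective C y \<le> CMESP_objective C x)"

definition DFact_feasible ::
  "nat \<Rightarrow> nat \<Rightarrow> nat \<Rightarrow> real mat \<Rightarrow> real mat \<Rightarrow>
   real mat \<Rightarrow> real vec \<Rightarrow> real vec \<Rightarrow> real vec \<Rightarrow> real \<Rightarrow> bool" where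
  "DFact_feasible n k m F A \<Theta> \<upsilon> \<nu> \<pi> \<tau> \<longleftrightarrow>
     pd_mat k \<Theta> \<and> \<upsilon> \<in> carrier_vec n \<and> \<nu> \<in> carrier_vec n \<and> \<pi> \<in> carrier_vec m \<and>
     diag_vec (F * \<Theta> * transpose_mat F) + \<upsilon> - \<nu> - transpose_mat A *\<^sub>v \<pi> - \<tau> \<cdot>\<^sub>v ones_vec n
       = 0\<^sub>v n \<and>
     0\<^sub>v n \<le> \<upsilon> \<and> 0\<^sub>v n \<le> \<nu> \<and> 0\<^sub>v m \<le> \<pi>"

definition DFact_objective ::
  "nat \<Rightarrow> nat \<Rightarrow> nat \<Rightarrow> real vec \<Rightarrow> real mat \<Rightarrow> real vec \<Rightarrow> real vec \<Rightarrow> real \<Rightarrow> real" where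
  "DFact_objective n k s b \<Theta> \<nu> \<pi> \<tau> =
     - (\<Sum>l = k - s + 1..k. ln (nth_greatest_eigenvalue l \<Theta>))
     + \<nu> \<bullet> ones_vec n + \<pi> \<bullet> b + \<tau> * real s - real s"

end

theory Submission
  imports Defs
begin

text \<open>Let x be feasible for CMESP with support S, and let G consist of the rows of F indexed by S, so
  that, with ' for transposition, C[S,S] = G G'. Diagonalising \<Theta> and expanding by Cauchy--Binet shows that
  det(G G') times the product of the s smallest eigenvalues of \<Theta> is at most det(G \<Theta> G'), and
  ln det M \<le> tr M - s for a positive definite M of order s because ln t \<le> t - 1. Substituting the
  equality constraint of DFact into tr(G \<Theta> G') bounds the duality gap at x from below by
  the sum of all \<upsilon>(j) x(j) + \<nu>(j) (1 - x(j)). When x is optimal this gap is at most \<zeta> - LB,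
  and each of the summands is nonnegative.\<close>

subsection \<open>The spectral theorem for real symmetric matrices\<close>

text \<open>Over the complex numbers the characteristic polynomial has a root \<open>z\<close>, with
  an eigenvector \<open>u\<close>. Symmetry of \<open>A\<close> forces \<open>Im z = 0\<close>, and
  then the real and the imaginary part of \<open>u\<close> each satisfy the eigenvector equation; at
  least one of them is nonzero and can be normalised.\<close>

lemma symmetric_real_eigenvector:
  fixes A :: "real mat"
  assumes A: "A \<in> carrier_mat n n" and sym: "transpose_mat A = A" and "n > 0"
  obtains v c where "v \<in> carrier_vec n" "v \<bullet> v = 1" "A *\<^sub>v v = c \<cdot>\<^sub>v v"
proof -
  let ?B = "map_mat complex_of_real A"
  have B: "?B \<in> carrier_mat n n" using A by auto
  from char_poly_factorized[OF B] obtain as where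
    as: "char_poly ?B = (\<Prod>a\<leftarrow>as. [:- a, 1:])" "length as = n" by auto
  with \<open>n > 0\<close> have "as \<noteq> []" by auto
  then have "poly (char_poly ?B) (hd as) = 0"
    unfolding as(1) by (cases as) auto
  then obtain z u where "eigenvector ?B u z"
    unfolding eigenvalue_root_char_poly[OF B, symmetric] eigenvalue_def by blast
  then have u: "u \<in> carrier_vec n" "u \<noteq> 0\<^sub>v n" and ev: "?B *\<^sub>v u = z \<cdot>\<^sub>v u"
    using B by (auto simp: eigenvector_def)
  define x y where "x = map_vec Re u" and "y = map_vec Im u"
  have x: "x \<in> carrier_vec n" and y: "y \<in> carrier_vec n" using u by (auto simp: x_def y_def)
  have row: "(\<Sum>j = 0..<n. complex_of_real (A $$ (i, j)) * u $ j) = z * u $ i" if "i < n" for i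
  proof -
    have "(?B *\<^sub>v u) $ i = (\<Sum>j = 0..<n. complex_of_real (A $$ (i, j)) * u $ j)"
      using that A u(1) by (auto simp: scalar_prod_def intro!: sum.cong)
    then show ?thesis using ev that u(1) by simp
  qed
  have Ax: "A *\<^sub>v x = Re z \<cdot>\<^sub>v x - Im z \<cdot>\<^sub>v y"
  proof (rule eq_vecI)
    fix i assume "i < dim_vec (Re z \<cdot>\<^sub>v x - Im z \<cdot>\<^sub>v y)"
    then have i: "i < n" using y by auto
    have "(A *\<^sub>v x) $ i = (\<Sum>j = 0..<n. A $$ (i, j) * Re (u $ j))"
      using i A u(1) by (auto simp: scalar_prod_def x_def intro!: sum.cong)
    also have "\<dots> = Re (\<Sum>j = 0..<n. complex_of_real (A $$ (i, j)) * u $ j)" by simp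
    finally show "(A *\<^sub>v x) $ i = (Re z \<cdot>\<^sub>v x - Im z \<cdot>\<^sub>v y) $ i"
      using i u(1) unfolding row[OF i] by (simp add: x_def y_def)
  qed (use A y in auto)
  have Ay: "A *\<^sub>v y = Re z \<cdot>\<^sub>v y + Im z \<cdot>\<^sub>v x"
  proof (rule eq_vecI)
    fix i assume "i < dim_vec (Re z \<cdot>\<^sub>v y + Im z \<cdot>\<^sub>v x)"
    then have i: "i < n" using x by auto
    have "(A *\<^sub>v y) $ i = (\<Sum>j = 0..<n. A $$ (i, j) * Im (u $ j))"
      using i A u(1) by (auto simp: scalar_prod_def y_def intro!: sum.cong)
    also have "\<dots> = Im (\<Sum>j = 0..<n. complex_of_real (A $$ (i, j)) * u $ j)" by simp
    finally show "(A *\<^sub>v y) $ i = (Re z \<cdot>\<^sub>v y + Im z \<cdot>\<^sub>v x) $ i"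
      using i u(1) unfolding row[OF i] by (simp add: x_def y_def)
  qed (use A x in auto)
  have nonneg: "0 \<le> w \<bullet> w" for w :: "real vec"
    unfolding scalar_prod_def by (intro sum_nonneg) auto
  have pos: "w \<bullet> w \<noteq> 0" if "w \<in> carrier_vec n" "w \<noteq> 0\<^sub>v n" for w :: "real vec"
  proof
    assume "w \<bullet> w = 0"
    then have "\<forall>i \<in> {0..<n}. w $ i * w $ i = 0"
      using that(1) unfolding scalar_prod_def by (subst (asm) sum_nonneg_eq_0_iff) auto
    then have "w = 0\<^sub>v n" using that(1) by (intro eq_vecI) auto
    with that show False by simp
  qed
  have nz: "x \<noteq> 0\<^sub>v n \<or> y \<noteq> 0\<^sub>v n"
  proof (rule ccontr)
    assume "\<not> ?thesis"
    then have "Re (u $ i) = 0" "Im (u $ i) = 0" if "i < n" for i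
      using that u(1) unfolding x_def y_def by (metis index_map_vec(1) index_zero_vec(1) carrier_vecD)+
    then have "u = 0\<^sub>v n" using u(1) by (intro eq_vecI) (auto simp: complex_eq_iff)
    with u show False by simp
  qed
  \<comment> \<open>Expanding both sides with \<open>Ax\<close> and \<open>Ay\<close>, the terms
    with \<open>Re z\<close> cancel and only a multiple of the squared norm of \<open>u\<close>
    remains.\<close>
  have "y \<bullet> (A *\<^sub>v x) = (A *\<^sub>v y) \<bullet> x"
    using transpose_vec_mult_scalar[OF A x y] sym by simp
  then have "Im z * (x \<bullet> x + y \<bullet> y) = 0"
    unfolding Ax Ay using x y
    by (simp add: scalar_prod_minus_distrib[of _ n] add_scalar_prod_distrib[of _ n]
        comm_scalar_prod[of y n x] algebra_simps)
  moreover have "x \<bullet> x + y \<bullet> y \<noteq> 0"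
    using nz pos[OF x] pos[OF y] nonneg[of x] nonneg[of y] by linarith
  ultimately have im: "Im z = 0" by simp
  obtain w where w: "w \<in> carrier_vec n" "w \<noteq> 0\<^sub>v n" "A *\<^sub>v w = Re z \<cdot>\<^sub>v w"
  proof (cases "x = 0\<^sub>v n")
    case True
    have "A *\<^sub>v y = Re z \<cdot>\<^sub>v y" unfolding Ay im using x y by (intro eq_vecI) auto
    then show ?thesis using that[OF y] nz True by simp
  next
    case False
    have "A *\<^sub>v x = Re z \<cdot>\<^sub>v x" unfolding Ax im using x y by (intro eq_vecI) auto
    then show ?thesis using that[OF x] False by simp
  qed
  let ?c = "1 / sqrt (w \<bullet> w)"
  show thesis
  proof (rule that)
    show "?c \<cdot>\<^sub>v w \<in> carrier_vec n" using w by simp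
    have "(?c \<cdot>\<^sub>v w) \<bullet> (?c \<cdot>\<^sub>v w) = ?c * ?c * (w \<bullet> w)" using w by simp
    also have "\<dots> = 1" using pos[OF w(1,2)] nonneg[of w] by simp
    finally show "(?c \<cdot>\<^sub>v w) \<bullet> (?c \<cdot>\<^sub>v w) = 1" .
    have "A *\<^sub>v (?c \<cdot>\<^sub>v w) = ?c \<cdot>\<^sub>v (A *\<^sub>v w)" using A w(1) by (rule mult_mat_vec)
    then show "A *\<^sub>v (?c \<cdot>\<^sub>v w) = Re z \<cdot>\<^sub>v (?c \<cdot>\<^sub>v w)"
      unfolding w(3) by (simp add: smult_smult_assoc mult.commute)
  qed
qed

text \<open>The reflection in the hyperplane orthogonal to \<open>v - unit_vec n 0\<close> swaps
  these two unit vectors. It serves to move an eigenvector to the first coordinate axis. If the two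
  vectors coincide there is no such hyperplane, and the identity does the job.\<close>

lemma householder_reflection:
  fixes v :: "real vec"
  assumes v: "v \<in> carrier_vec n" and unit: "v \<bullet> v = 1" and "n > 0"
  obtains H where "H \<in> carrier_mat n n" "transpose_mat H = H" "H * H = 1\<^sub>m n"
    "H *\<^sub>v unit_vec n 0 = v"
proof (cases "v = unit_vec n 0")
  case True
  show ?thesis by (rule that[of "1\<^sub>m n"]) (simp_all add: True)
next
  case False
  define w where "w = v - unit_vec n 0"
  define c where "c = 2 / (w \<bullet> w)"
  define H where "H = mat n n (\<lambda>(i, j). (if i = j then 1 else 0) - c * w $ i * w $ j)"
  have w: "w \<in> carrier_vec n" using v by (simp add: w_def)
  have ww: "w \<bullet> w = 2 - 2 * v $ 0"
    unfolding w_def using v unit \<open>n > 0\<close>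
    by (simp add: scalar_prod_minus_distrib[of _ n] minus_scalar_prod_distrib[of _ n]
        comm_scalar_prod[of v n "unit_vec n 0"])
  have "w \<bullet> w \<noteq> 0"
  proof
    assume "w \<bullet> w = 0"
    then have "\<forall>i \<in> {0..<n}. w $ i * w $ i = 0"
      using w unfolding scalar_prod_def by (subst (asm) sum_nonneg_eq_0_iff) auto
    then have *: "w $ i = 0" if "i < n" for i using that by auto
    have "v = unit_vec n 0"
    proof (rule eq_vecI)
      show "v $ i = unit_vec n 0 $ i" if "i < dim_vec (unit_vec n 0 :: real vec)" for i
        using *[of i] that v unfolding w_def by simp
    qed (use v in auto)
    with False show False by simp
  qed
  then have cw: "c * (w \<bullet> w) = 2" by (simp add: c_def)
  have H: "H \<in> carrier_mat n n" by (simp add: H_def)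
  have "H * H = 1\<^sub>m n"
  proof (rule eq_matI)
    fix i j assume "i < dim_row (1\<^sub>m n)" "j < dim_col (1\<^sub>m n)"
    then have ij: "i < n" "j < n" by auto
    let ?d = "\<lambda>i j :: nat. if i = j then 1 else 0 :: real"
    have "(H * H) $$ (i, j) = (\<Sum>l = 0..<n. (?d i l - c * w $ i * w $ l) * (?d l j - c * w $ l * w $ j))"
      using ij by (auto simp: H_def scalar_prod_def)
    \<comment> \<open>The square of \<open>1 - c w w'\<close> is
      \<open>1 - 2 c w w' + c (c (w \<bullet> w)) w w'\<close>, and \<open>c\<close> was chosen so
      that \<open>c * (w \<bullet> w) = 2\<close>.\<close>
    also have "\<dots> = (\<Sum>l = 0..<n. ?d i l * ?d l j) - (\<Sum>l = 0..<n. ?d i l * (c * w $ l * w $ j))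
        - (\<Sum>l = 0..<n. ?d l j * (c * w $ i * w $ l)) + c * w $ i * w $ j * (c * (\<Sum>l = 0..<n. w $ l * w $ l))"
      by (simp add: sum_subtractf sum.distrib sum_distrib_left algebra_simps)
    also have "(\<Sum>l = 0..<n. w $ l * w $ l) = w \<bullet> w" using w by (simp add: scalar_prod_def)
    also have "(\<Sum>l = 0..<n. ?d i l * ?d l j) = ?d i j" using ij by (simp add: if_distrib[of "\<lambda>x. x * _"] sum.delta cong: if_cong)
    also have "(\<Sum>l = 0..<n. ?d i l * (c * w $ l * w $ j)) = c * w $ i * w $ j"
      using ij by (simp add: if_distrib[of "\<lambda>x. x * _"] sum.delta cong: if_cong)
    also have "(\<Sum>l = 0..<n. ?d l j * (c * w $ i * w $ l)) = c * w $ i * w $ j"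
      using ij by (simp add: if_distrib[of "\<lambda>x. x * _"] sum.delta' cong: if_cong)
    finally show "(H * H) $$ (i, j) = 1\<^sub>m n $$ (i, j)" using ij unfolding cw by simp
  qed (auto simp: H_def)
  moreover have "transpose_mat H = H" by (intro eq_matI) (auto simp: H_def)
  moreover have "H *\<^sub>v unit_vec n 0 = v"
  proof (rule eq_vecI)
    fix i assume "i < dim_vec v"
    then have i: "i < n" using v by simp
    have "(H *\<^sub>v unit_vec n 0) $ i = H $$ (i, 0)" using i \<open>n > 0\<close> H by simp
    also have "\<dots> = (if i = 0 then 1 else 0) - c * w $ i * w $ 0" using i \<open>n > 0\<close> by (simp add: H_def)
    \<comment> \<open>Since \<open>w $ 0\<close> is minus half of \<open>w \<bullet> w\<close>, the
      factor \<open>c * w $ 0\<close> is -1, so column 0 of \<open>H\<close> is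
      \<open>unit_vec n 0 + w\<close>, that is, \<open>v\<close>.\<close>
    also have "c * w $ i * w $ 0 = - w $ i"
    proof -
      have "w $ 0 = - (w \<bullet> w) / 2" unfolding ww using v \<open>n > 0\<close> by (simp add: w_def)
      then have "c * w $ i * w $ 0 = - (c * (w \<bullet> w)) * w $ i / 2" by simp
      then show ?thesis unfolding cw by simp
    qed
    finally show "(H *\<^sub>v unit_vec n 0) $ i = v $ i" using i v by (auto simp: w_def)
  qed (use v in \<open>auto simp: H_def\<close>)
  ultimately show ?thesis using that[OF H] by blast
qed

text \<open>Deflation by induction on the order: conjugating with a Householder reflection splits
  off one eigenvalue as a corner block, and the induction hypothesis diagonalises the complementary
  block.\<close>

theorem real_spectral_theorem:
  fixes A :: "real mat"
  assumes "A \<in> carrier_mat n n" and "transpose_mat A = A"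
  shows "\<exists>U \<mu>. U \<in> carrier_mat n n \<and> transpose_mat U * U = 1\<^sub>m n \<and>
    A = U * mat_diag n \<mu> * transpose_mat U"
  using assms
proof (induction n arbitrary: A)
  case 0
  then show ?case by (intro exI[of _ "1\<^sub>m 0"] exI[of _ "\<lambda>_. 0"]) auto
next
  case (Suc n)
  note A = Suc.prems(1)
  obtain v c where v: "v \<in> carrier_vec (Suc n)" "v \<bullet> v = 1" and ev: "A *\<^sub>v v = c \<cdot>\<^sub>v v"
    using symmetric_real_eigenvector[OF Suc.prems] by auto
  obtain H where H: "H \<in> carrier_mat (Suc n) (Suc n)" and Ht: "transpose_mat H = H"
    and HH: "H * H = 1\<^sub>m (Suc n)" and He: "H *\<^sub>v unit_vec (Suc n) 0 = v"
    using householder_reflection[OF v] by auto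
  let ?e = "unit_vec (Suc n) 0 :: real vec"
  have Hv: "H *\<^sub>v v = ?e"
    unfolding He[symmetric] using H HH by (simp add: assoc_mult_mat_vec[symmetric, OF H H])
  \<comment> \<open>\<open>H\<close> exchanges \<open>v\<close> and the first basis vector, so the
    latter is an eigenvector of \<open>B\<close>. This clears column 0 below the corner, and
    symmetry of \<open>B\<close> clears row 0.\<close>
  define B where "B = H * A * H"
  have B: "B \<in> carrier_mat (Suc n) (Suc n)" using H A by (simp add: B_def)
  have Bt: "transpose_mat B = B"
    unfolding B_def using H A
    by (simp add: transpose_mult[of _ "Suc n" "Suc n" _ "Suc n"] Ht Suc.prems(2)
        assoc_mult_mat[of _ "Suc n" "Suc n" _ "Suc n" _ "Suc n"])
  have "B *\<^sub>v ?e = H *\<^sub>v (A *\<^sub>v (H *\<^sub>v ?e))"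
    unfolding B_def using H A by (simp add: assoc_mult_mat_vec[of _ "Suc n" "Suc n" _ "Suc n"])
  also have "\<dots> = c \<cdot>\<^sub>v ?e" unfolding He ev using mult_mat_vec[OF H v(1)] Hv by simp
  finally have Be: "B *\<^sub>v ?e = c \<cdot>\<^sub>v ?e" .
  have B0: "B $$ (i, 0) = (if i = 0 then c else 0)" if "i < Suc n" for i
    using arg_cong[OF Be, of "\<lambda>w. w $ i"] that B by auto
  have B0': "B $$ (0, i) = (if i = 0 then c else 0)" if "i < Suc n" for i
    using B0[OF that] that Bt B by (metis index_transpose_mat(1) carrier_matD zero_less_Suc)
  define A' where "A' = mat n n (\<lambda>(i, j). B $$ (Suc i, Suc j))"
  have A': "A' \<in> carrier_mat n n" by (simp add: A'_def)
  have "transpose_mat A' = A'"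
  proof (rule eq_matI)
    fix i j assume "i < dim_row A'" "j < dim_col A'"
    then have "i < n" "j < n" by (auto simp: A'_def)
    then have "transpose_mat A' $$ (i, j) = transpose_mat B $$ (Suc i, Suc j)"
      using B by (simp add: A'_def)
    then show "transpose_mat A' $$ (i, j) = A' $$ (i, j)"
      using \<open>i < n\<close> \<open>j < n\<close> by (simp add: Bt A'_def)
  qed (auto simp: A'_def)
  from Suc.IH[OF A' this] obtain U \<mu> where U: "U \<in> carrier_mat n n"
    and UU: "transpose_mat U * U = 1\<^sub>m n" and AU: "A' = U * mat_diag n \<mu> * transpose_mat U"
    by blast
  \<comment> \<open>\<open>U\<close> diagonalises only the lower right block \<open>A'\<close>;
    bordering it with a 1 keeps it orthogonal and leaves the corner entry \<open>c\<close>
    alone.\<close>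
  define V where "V = four_block_mat (1\<^sub>m 1) (0\<^sub>m 1 n) (0\<^sub>m n 1) U"
  define \<mu>' where "\<mu>' = case_nat c \<mu>"
  have V: "V \<in> carrier_mat (Suc n) (Suc n)"
    using U four_block_carrier_mat[of "1\<^sub>m 1" 1 1 U n n] by (simp add: V_def)
  have Vt: "transpose_mat V = four_block_mat (1\<^sub>m 1) (0\<^sub>m 1 n) (0\<^sub>m n 1) (transpose_mat U)"
    unfolding V_def using U by (subst transpose_four_block_mat[of _ 1 1 _ n _ n]) auto
  have D: "mat_diag (Suc n) \<mu>' = four_block_mat (mat 1 1 (\<lambda>_. c)) (0\<^sub>m 1 n) (0\<^sub>m n 1) (mat_diag n \<mu>)"
    by (intro eq_matI) (auto simp: mat_diag_def \<mu>'_def split: nat.splits)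
  have VV: "transpose_mat V * V = 1\<^sub>m (Suc n)"
    unfolding Vt unfolding V_def using U UU
    by (subst mult_four_block_mat[of _ 1 1 _ n _ n _ _ 1 _ n]) (auto intro!: eq_matI)
  have "B = four_block_mat (mat 1 1 (\<lambda>_. c)) (0\<^sub>m 1 n) (0\<^sub>m n 1) A'"
    using B by (intro eq_matI) (auto simp: A'_def B0 B0')
  also have "\<dots> = V * mat_diag (Suc n) \<mu>' * transpose_mat V"
  proof -
    have "V * mat_diag (Suc n) \<mu>' = four_block_mat (mat 1 1 (\<lambda>_. c)) (0\<^sub>m 1 n) (0\<^sub>m n 1) (U * mat_diag n \<mu>)"
      unfolding V_def D using U
      by (subst mult_four_block_mat[of _ 1 1 _ n _ n _ _ 1 _ n])
        (auto simp: left_mult_zero_mat[OF mat_diag_dim])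
    then show ?thesis
      unfolding Vt using U
      by (simp, subst mult_four_block_mat[of _ 1 1 _ n _ n _ _ 1 _ n])
        (auto simp: AU right_mult_zero_mat[of _ n n] left_add_zero_mat[of _ n n])
  qed
  finally have BV: "B = V * mat_diag (Suc n) \<mu>' * transpose_mat V" .
  note assoc = assoc_mult_mat[of _ "Suc n" "Suc n" _ "Suc n" _ "Suc n"]
    mult_carrier_mat[of _ "Suc n" "Suc n" _ "Suc n"]
  have HVt: "transpose_mat (H * V) = transpose_mat V * H"
    using H V by (simp add: transpose_mult Ht)
  have "H * B * H = (H * H) * A * (H * H)"
    unfolding B_def using H A by (simp add: assoc)
  then have "A = H * B * H" using A by (simp add: HH)
  also have "\<dots> = (H * V) * mat_diag (Suc n) \<mu>' * transpose_mat (H * V)"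
    unfolding HVt BV using H V by (simp add: assoc)
  finally have eq: "A = (H * V) * mat_diag (Suc n) \<mu>' * transpose_mat (H * V)" .
  have "transpose_mat (H * V) * (H * V) = transpose_mat V * ((H * H) * V)"
    unfolding HVt using H V by (simp add: assoc)
  also have "\<dots> = 1\<^sub>m (Suc n)" using V VV by (simp add: HH)
  finally show ?case using eq H V by (intro exI[of _ "H * V"] exI[of _ \<mu>']) auto
qed

subsection \<open>Determinants of weighted Gram matrices\<close>

text \<open>The sum runs over all maps of the row indices to the column indices rather than over sets of
  s columns, so every set is counted s! times (once for each ordering). The identity outside
  the row indices only makes the extension of the maps unique.\<close>

lemma weighted_cauchy_binet:
  fixes G :: "real mat"
  assumes G: "G \<in> carrier_mat s k"
  defines "F \<equiv> {f. (\<forall>i\<in>{0..<s}. f i \<in> {0..<k}) \<and> (\<forall>i. i \<notin> {0..<s} \<longrightarrow> f i = i)}"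
  shows "fact s * det (G * mat_diag k w * transpose_mat G) =
    (\<Sum>f\<in>F. (\<Prod>i = 0..<s. w (f i)) * (det (mat s s (\<lambda>(i, j). G $$ (i, f j))))\<^sup>2)"
proof -
  let ?U = "{0..<s}"
  let ?P = "{p. p permutes ?U}"
  let ?inv = Hilbert_Choice.inv
  define H where "H f = mat s s (\<lambda>(i, j). G $$ (j, f i))" for f
  define W where "W f = (\<Prod>i\<in>?U. w (f i))" for f
  have H: "H f \<in> carrier_mat s s" for f by (simp add: H_def)
  have Ht: "mat s s (\<lambda>(i, j). G $$ (i, f j)) = transpose_mat (H f)" for f
    by (intro eq_matI) (auto simp: H_def)
  \<comment> \<open>The summand that multilinearity in the rows yields for \<open>f\<close>. It is
    lopsided: one factor is a whole minor, the other only a single product of entries of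
    \<open>G\<close>.\<close>
  define t where "t f = (\<Prod>i\<in>?U. G $$ (i, f i)) * W f * det (H f)" for f
  have GD: "G * mat_diag k w = mat s k (\<lambda>(i, j). G $$ (i, j) * w j)"
    by (rule mat_diag_mult_right[OF G])
  have "det (G * mat_diag k w * transpose_mat G) =
    (\<Sum>f\<in>F. det (mat\<^sub>r s s (\<lambda>i. (G * mat_diag k w) $$ (i, f i) \<cdot>\<^sub>v row (transpose_mat G) (f i))))"
    unfolding F_def using G
    by (subst mat_mul_finsum_alt[of _ s k _ s], simp, simp, subst det_linear_rows_sum) auto
  also have "\<dots> = (\<Sum>f\<in>F. t f)"
  proof (rule sum.cong[OF refl])
    fix f assume f: "f \<in> F"
    have "det (mat\<^sub>r s s (\<lambda>i. (G * mat_diag k w) $$ (i, f i) \<cdot>\<^sub>v row (transpose_mat G) (f i))) =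
      (\<Prod>i\<in>?U. (G * mat_diag k w) $$ (i, f i)) * det (mat\<^sub>r s s (\<lambda>i. row (transpose_mat G) (f i)))"
      using G f by (intro det_rows_mul) (auto simp: F_def)
    also have "mat\<^sub>r s s (\<lambda>i. row (transpose_mat G) (f i)) = H f"
      using G f by (intro eq_matI) (auto simp: H_def F_def)
    also have "(\<Prod>i\<in>?U. (G * mat_diag k w) $$ (i, f i)) = (\<Prod>i\<in>?U. G $$ (i, f i) * w (f i))"
      using f by (intro prod.cong) (auto simp: GD F_def)
    finally show "det (mat\<^sub>r s s (\<lambda>i. (G * mat_diag k w) $$ (i, f i) \<cdot>\<^sub>v row (transpose_mat G) (f i))) = t f"
      by (simp add: t_def W_def prod.distrib)
  qed
  finally have det: "det (G * mat_diag k w * transpose_mat G) = (\<Sum>f\<in>F. t f)" .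
  \<comment> \<open>Precomposition with \<open>p\<close> is a bijection of \<open>F\<close>.
    Averaging over all \<open>p\<close> will complete the single product of entries to a second copy
    of the minor.\<close>
  have shift: "(\<Sum>f\<in>F. t f) = (\<Sum>f\<in>F. t (f \<circ> p))" if "p \<in> ?P" for p
  proof (rule sum.reindex_bij_witness[of _ "\<lambda>f. f \<circ> p" "\<lambda>f. f \<circ> ?inv p"])
    have p: "p permutes ?U" using that by simp
    have comp: "f \<circ> q \<in> F" if "f \<in> F" "q permutes ?U" for f q
      using that permutes_in_image[OF that(2)] by (auto simp: F_def permutes_def)
    show "f \<circ> p \<in> F" if "f \<in> F" for f using comp[OF that p] .
    show "f \<circ> ?inv p \<in> F" if "f \<in> F" for f using comp[OF that permutes_inv[OF p]] .
    show "f \<circ> ?inv p \<circ> p = f" "f \<circ> p \<circ> ?inv p = f" for f :: "nat \<Rightarrow> nat"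
      by (auto simp: fun_eq_iff permutes_inverses[OF p])
    then show "t (f \<circ> ?inv p \<circ> p) = t f" for f by simp
  qed
  \<comment> \<open>The weight ignores the order of the columns and the minor picks up the sign of
    \<open>p\<close>, so what depends on \<open>p\<close> is exactly a summand of the Leibniz
    formula.\<close>
  have tp: "t (f \<circ> p) = W f * det (H f) * (signof p * (\<Prod>i\<in>?U. transpose_mat (H f) $$ (i, p i)))"
    if p: "p \<in> ?P" for p f
  proof -
    have pU: "p permutes ?U" using p by simp
    have "W (f \<circ> p) = W f"
      unfolding W_def o_def using prod.permute[OF pU, of "\<lambda>i. w (f i)"] by (simp add: o_def)
    moreover have "H (f \<circ> p) = mat s s (\<lambda>(i, j). H f $$ (p i, j))"
      using permutes_in_image[OF pU] by (intro eq_matI) (auto simp: H_def)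
    then have "det (H (f \<circ> p)) = signof p * det (H f)"
      using det_permute_rows[OF H pU] by simp
    moreover have "(\<Prod>i\<in>?U. G $$ (i, (f \<circ> p) i)) = (\<Prod>i\<in>?U. transpose_mat (H f) $$ (i, p i))"
      using permutes_in_image[OF pU] by (intro prod.cong) (auto simp: H_def)
    ultimately show ?thesis by (simp add: t_def)
  qed
  have "fact s * det (G * mat_diag k w * transpose_mat G) = (\<Sum>p\<in>?P. \<Sum>f\<in>F. t f)"
    unfolding det by (simp add: card_permutations)
  also have "\<dots> = (\<Sum>p\<in>?P. \<Sum>f\<in>F. t (f \<circ> p))" by (intro sum.cong refl shift)
  also have "\<dots> = (\<Sum>f\<in>F. \<Sum>p\<in>?P. t (f \<circ> p))" by (rule sum.swap)
  also have "\<dots> = (\<Sum>f\<in>F. W f * (det (transpose_mat (H f)))\<^sup>2)"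
  proof (rule sum.cong[OF refl])
    fix f
    have "(\<Sum>p\<in>?P. t (f \<circ> p)) =
        W f * det (H f) * (\<Sum>p\<in>?P. signof p * (\<Prod>i\<in>?U. transpose_mat (H f) $$ (i, p i)))"
      unfolding sum_distrib_left by (intro sum.cong refl tp)
    also have "(\<Sum>p\<in>?P. signof p * (\<Prod>i\<in>?U. transpose_mat (H f) $$ (i, p i))) = det (transpose_mat (H f))"
      using H[of f] by (subst det_def'[of _ s]) auto
    finally show "(\<Sum>p\<in>?P. t (f \<circ> p)) = W f * (det (transpose_mat (H f)))\<^sup>2"
      using det_transpose[OF H[of f]] by (simp add: power2_eq_square mult.assoc o_def)
  qed
  finally show ?thesis unfolding Ht W_def .
qed

text \<open>Both determinants are expanded by \<open>weighted_cauchy_binet\<close>, the left one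
  with unit weights, and compared term by term. An injective map has an image of \<open>s\<close>
  elements, to which the bound \<open>c\<close> applies; any other map repeats a column, and its
  minor vanishes.\<close>

lemma det_weighted_gram_ge:
  fixes G :: "real mat"
  assumes G: "G \<in> carrier_mat s k"
    and c: "\<And>T. T \<subseteq> {0..<k} \<Longrightarrow> card T = s \<Longrightarrow> c \<le> prod w T"
  shows "c * det (G * transpose_mat G) \<le> det (G * mat_diag k w * transpose_mat G)"
proof -
  define F where "F = {f. (\<forall>i\<in>{0..<s}. f i \<in> {0..<k}) \<and> (\<forall>i. i \<notin> {0..<s} \<longrightarrow> f i = i)}"
  define d where "d f = det (mat s s (\<lambda>(i, j). G $$ (i, f j)))" for f
  have "fact s * (c * det (G * transpose_mat G)) = c * (fact s * det (G * mat_diag k (\<lambda>_. 1) * transpose_mat G))"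
    using G by simp
  also have "\<dots> = (\<Sum>f\<in>F. c * (d f)\<^sup>2)"
    unfolding weighted_cauchy_binet[OF G] F_def d_def sum_distrib_left by simp
  also have "\<dots> \<le> (\<Sum>f\<in>F. (\<Prod>i = 0..<s. w (f i)) * (d f)\<^sup>2)"
  proof (rule sum_mono)
    fix f assume f: "f \<in> F"
    show "c * (d f)\<^sup>2 \<le> (\<Prod>i = 0..<s. w (f i)) * (d f)\<^sup>2"
    proof (cases "inj_on f {0..<s}")
      case True
      have "c \<le> prod w (f ` {0..<s})"
        using f True by (intro c) (auto simp: F_def card_image)
      also have "\<dots> = (\<Prod>i = 0..<s. w (f i))" using True by (simp add: prod.reindex)
      finally show ?thesis by (intro mult_right_mono) auto
    next
      case False
      then obtain i j where ij: "i < s" "j < s" "i \<noteq> j" "f i = f j" by (auto simp: inj_on_def)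
      have "d f = 0" unfolding d_def
        using ij by (intro det_identical_columns[of _ s i j]) auto
      then show ?thesis by simp
    qed
  qed
  also have "\<dots> = fact s * det (G * mat_diag k w * transpose_mat G)"
    unfolding weighted_cauchy_binet[OF G] F_def d_def by simp
  finally show ?thesis by simp
qed

lemma det_gram_nonneg:
  fixes G :: "real mat"
  assumes G: "G \<in> carrier_mat s k"
  shows "0 \<le> det (G * transpose_mat G)"
  using det_weighted_gram_ge[OF G, of 0 "\<lambda>_. 1"] G by simp

text \<open>Removing the maximum of \<open>T\<close> drives the induction: a set of
  \<open>Suc m\<close> indices has a maximum of at least \<open>m\<close>, so the removed factor is
  at least \<open>a m\<close>. Applied to sorted eigenvalues, it says that the smallest ones
  minimise the product.\<close>

lemma prod_first_le_prod_subset: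
  fixes a :: "nat \<Rightarrow> real"
  assumes "mono_on {..<k} a" and "\<And>i. i < k \<Longrightarrow> 0 \<le> a i" and "T \<subseteq> {..<k}"
  shows "(\<Prod>i<card T. a i) \<le> prod a T"
  using assms(3)
proof (induction "card T" arbitrary: T)
  case 0
  then have "T = {}" using finite_subset[of T "{..<k}"] by simp
  then show ?case by simp
next
  case (Suc m)
  have fin: "finite T" using Suc.prems finite_subset by blast
  then have ne: "T \<noteq> {}" using Suc.hyps(2) by auto
  let ?x = "Max T"
  have x: "?x \<in> T" using fin ne by (rule Max_in)
  have "T \<subseteq> {..?x}" using fin by auto
  then have "card T \<le> Suc ?x" using card_mono[of "{..?x}" T] by simp
  then have "m \<le> ?x" using Suc.hyps(2) by simp
  then have "a m \<le> a ?x" using x Suc.prems by (intro mono_onD[OF assms(1)]) auto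
  moreover have card: "card (T - {?x}) = m" using Suc.hyps(2) x fin by simp
  have "(\<Prod>i<m. a i) \<le> prod a (T - {?x})"
    using Suc.hyps(1)[of "T - {?x}"] Suc.prems unfolding card by auto
  moreover have "0 \<le> a m" "0 \<le> prod a (T - {?x})"
    using \<open>m \<le> ?x\<close> x Suc.prems by (auto intro!: assms(2) prod_nonneg)
  ultimately have "(\<Prod>i<m. a i) * a m \<le> prod a (T - {?x}) * a ?x"
    by (intro mult_mono)
  then show ?case
    unfolding Suc.hyps(2)[symmetric] using prod.remove[OF fin x, of a] by (simp add: mult.commute)
qed

subsection \<open>Eigenvalues, determinant and trace\<close>

context
  fixes n :: nat and U :: "real mat" and \<mu> :: "nat \<Rightarrow> real" and M :: "real mat"
  assumes U: "U \<in> carrier_mat n n" and UU: "transpose_mat U * U = 1\<^sub>m n"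
    and M: "M = U * mat_diag n \<mu> * transpose_mat U"
begin

lemma orthogonal_mult_transpose: "U * transpose_mat U = 1\<^sub>m n"
  using U by (intro mat_mult_left_right_inverse[OF _ U UU]) simp

lemma orthogonal_col_norm: "j < n \<Longrightarrow> col U j \<bullet> col U j = 1"
  using arg_cong[OF UU, of "\<lambda>N. N $$ (j, j)"] U by simp

lemma orthogonal_diag_similar: "similar_mat M (mat_diag n \<mu>)"
  using U UU orthogonal_mult_transpose M by (intro similar_matI[of _ _ U "transpose_mat U" n]) auto

text \<open>The columns of \<open>U\<close> are unit eigenvectors. Testing the quadratic form on
  them transfers definiteness of \<open>M\<close> to the signs of the
  \<open>\<mu> j\<close>.\<close>

lemma rayleigh_quotient_col:
  assumes j: "j < n"
  shows "col U j \<bullet> (M *\<^sub>v col U j) = \<mu> j"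
proof -
  have "M * U = U * mat_diag n \<mu> * (transpose_mat U * U)"
    unfolding M using U by (simp add: assoc_mult_mat[of _ n n _ n _ n] mult_carrier_mat[of _ n n])
  then have "M * U = mat n n (\<lambda>(i, j). U $$ (i, j) * \<mu> j)"
    using U by (simp add: UU mat_diag_mult_right[OF U])
  then have "col (M * U) j = \<mu> j \<cdot>\<^sub>v col U j"
    using U j by (intro eq_vecI) auto
  moreover have "col (M * U) j = M *\<^sub>v col U j"
    using U j M by (intro eq_vecI) auto
  ultimately show ?thesis using orthogonal_col_norm[OF j] by simp
qed

lemma diag_mat_mat_diag: "diag_mat (mat_diag n \<mu>) = map \<mu> [0..<n]"
  by (intro nth_equalityI) (auto simp: diag_mat_def mat_diag_def)

text \<open>This links the diagonal \<open>\<mu>\<close>, which comes in no particular order, to the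
  multiset of roots in the definition of \<open>nth_greatest_eigenvalue\<close>.\<close>

lemma proots_char_poly_orthogonal_diag: "proots (char_poly M) = mset (map \<mu> [0..<n])"
proof -
  have "char_poly M = (\<Prod>a\<leftarrow>map \<mu> [0..<n]. [:- a, 1:])"
    unfolding char_poly_similar[OF orthogonal_diag_similar] diag_mat_mat_diag[symmetric]
    by (rule char_poly_upper_triangular) (auto simp: mat_diag_def)
  moreover have "proots (\<Prod>a\<leftarrow>as. [:- a, 1:]) = mset as" for as :: "real list"
    
    by (induction as) (subst list.map prod_list.Nil prod_list.Cons proots_mult | force simp: prod_list_zero_iff)+
  ultimately show ?thesis by (simp only:)
qed

lemma det_orthogonal_diag: "det M = (\<Prod>j<n. \<mu> j)"
proof -
  have "det M = prod_list (diag_mat (mat_diag n \<mu>))"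
    unfolding det_similar[OF orthogonal_diag_similar]
    by (rule det_upper_triangular) (auto simp: mat_diag_def)
  then show ?thesis
    unfolding diag_mat_mat_diag by (simp add: prod.distinct_set_conv_list[symmetric] atLeast0LessThan)
qed

lemma trace_orthogonal_diag: "(\<Sum>i<n. M $$ (i, i)) = (\<Sum>j<n. \<mu> j)"
proof -
  have "(\<Sum>i<n. M $$ (i, i)) = (\<Sum>i<n. \<Sum>j<n. \<mu> j * (U $$ (i, j) * U $$ (i, j)))"
    unfolding M using U
    by (intro sum.cong refl)
      (simp add: mat_diag_mult_right[OF U] scalar_prod_def atLeast0LessThan algebra_simps)
  also have "\<dots> = (\<Sum>j<n. \<mu> j * (\<Sum>i<n. U $$ (i, j) * U $$ (i, j)))"
    unfolding sum_distrib_left by (rule sum.swap)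
  also have "\<dots> = (\<Sum>j<n. \<mu> j)"
    using orthogonal_col_norm U by (intro sum.cong refl) (simp add: scalar_prod_def atLeast0LessThan)
  finally show ?thesis .
qed

end

text \<open>The number \<open>c\<close> is the product of the \<open>s\<close> smallest of the
  \<open>\<mu> j\<close>: the sum in the objective of DFact is its logarithm, and it is the weight
  bound that \<open>det_weighted_gram_ge\<close> asks for.\<close>

lemma sum_nth_greatest_eigenvalue:
  assumes U: "U \<in> carrier_mat k k" "transpose_mat U * U = 1\<^sub>m k"
      "M = U * mat_diag k \<mu> * transpose_mat U"
    and pos: "\<And>j. j < k \<Longrightarrow> 0 < \<mu> j" and "s \<le> k"
  obtains c where "0 < c" "(\<Sum>l = k - s + 1..k. ln (nth_greatest_eigenvalue l M)) = ln c"
    "\<And>T. T \<subseteq> {0..<k} \<Longrightarrow> card T = s \<Longrightarrow> c \<le> prod \<mu> T"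
proof -
  define L where "L = sort (map \<mu> [0..<k])"
  have len: "length L = k" by (simp add: L_def)
  have "mset (map \<mu> [0..<k]) = mset L" by (simp add: L_def)
  \<comment> \<open>\<open>p\<close> matches positions in \<open>\<mu>\<close> with positions in the
    sorted list, so repeated eigenvalues are counted correctly.\<close>
  then obtain p where p: "p permutes {..<length L}" "permute_list p L = map \<mu> [0..<k]"
    by (rule mset_eq_permutation)
  have \<mu>: "\<mu> j = L ! p j" if "j < k" for j
    using arg_cong[OF p(2), of "\<lambda>xs. xs ! j"] permute_list_nth[OF p(1), of j] that len by simp
  have Lpos: "0 < L ! i" if "i < k" for i
  proof -
    have "L ! i \<in> set L" using that len by simp
    then show ?thesis using pos by (auto simp: L_def)
  qed
  \<comment> \<open>\<open>L\<close> is increasing and indexed from 0 while eigenvalues are counted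
    from 1 downwards in size; \<open>l\<close> from \<open>k - s + 1\<close> to \<open>k\<close>
    thus covers the positions below \<open>s\<close>.\<close>
  have ev: "nth_greatest_eigenvalue l M = L ! (k - l)" if "l \<in> {k - s + 1..k}" for l
  proof -
    have "nth_greatest_eigenvalue l M = rev L ! (l - 1)"
      unfolding nth_greatest_eigenvalue_def proots_char_poly_orthogonal_diag[OF U] L_def
        sorted_list_of_multiset_mset ..
    then show ?thesis using that len \<open>s \<le> k\<close> by (auto simp: rev_nth)
  qed
  have "(\<Sum>l = k - s + 1..k. ln (nth_greatest_eigenvalue l M)) = (\<Sum>l = k - s + 1..k. ln (L ! (k - l)))"
    by (intro sum.cong refl) (simp only: ev)
  also have "\<dots> = (\<Sum>i<s. ln (L ! i))"
    using \<open>s \<le> k\<close> by (intro sum.reindex_bij_witness[of _ "\<lambda>i. k - i" "\<lambda>l. k - l"]) auto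
  also have "\<dots> = ln (\<Prod>i<s. L ! i)"
    using \<open>s \<le> k\<close> Lpos by (intro ln_prod[symmetric]) (auto simp: less_imp_neq[symmetric])
  finally have ln: "(\<Sum>l = k - s + 1..k. ln (nth_greatest_eigenvalue l M)) = ln (\<Prod>i<s. L ! i)" .
  show thesis
  proof (rule that[OF _ ln])
    show "0 < (\<Prod>i<s. L ! i)" using \<open>s \<le> k\<close> Lpos by (intro prod_pos) auto
    fix T assume T: "T \<subseteq> {0..<k}" "card T = s"
    have inj: "inj_on p T" using p(1) permutes_inj_on by blast
    have pT: "p ` T \<subseteq> {..<k}" using permutes_in_image[OF p(1)] T(1) len by auto
    have "(\<Prod>i<card (p ` T). L ! i) \<le> prod ((!) L) (p ` T)"
    proof (rule prod_first_le_prod_subset[OF _ _ pT])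
      show "mono_on {..<k} ((!) L)"
        using len by (intro mono_onI sorted_nth_mono) (auto simp: L_def)
      show "0 \<le> L ! i" if "i < k" for i using Lpos[OF that] by simp
    qed
    also have "\<dots> = prod \<mu> T"
      unfolding prod.reindex[OF inj] o_def using T(1) \<mu> by (intro prod.cong) auto
    finally show "(\<Prod>i<s. L ! i) \<le> prod \<mu> T" using T(2) card_image[OF inj] by simp
  qed
qed

text \<open>The inequality \<open>ln t \<le> t - 1\<close> is summed over the eigenvalues. They are
  nonnegative by semidefiniteness and nonzero because the determinant is.\<close>

lemma ln_det_le_trace:
  assumes M: "psd_mat n M" and "det M \<noteq> 0"
  shows "ln (det M) \<le> (\<Sum>i<n. M $$ (i, i)) - real n"
proof -
  obtain U \<mu> where U: "U \<in> carrier_mat n n" "transpose_mat U * U = 1\<^sub>m n"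
    "M = U * mat_diag n \<mu> * transpose_mat U"
    using real_spectral_theorem[of M n] M unfolding psd_mat_def by auto
  have "\<mu> j \<noteq> 0" if "j < n" for j
    using \<open>det M \<noteq> 0\<close> that unfolding det_orthogonal_diag[OF U] by auto
  moreover have "0 \<le> \<mu> j" if "j < n" for j
    using M U(1) that unfolding rayleigh_quotient_col[OF U that, symmetric] psd_mat_def by auto
  ultimately have pos: "0 < \<mu> j" if "j < n" for j using that by (simp add: less_le)
  have "ln (det M) = (\<Sum>j<n. ln (\<mu> j))"
    unfolding det_orthogonal_diag[OF U] using pos by (intro ln_prod) (auto simp: less_imp_neq[symmetric])
  also have "\<dots> \<le> (\<Sum>j<n. \<mu> j - 1)"
    using pos by (intro sum_mono ln_le_minus_one) auto
  also have "\<dots> = (\<Sum>i<n. M $$ (i, i)) - real n"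
    unfolding trace_orthogonal_diag[OF U] by (simp add: sum_subtractf)
  finally show ?thesis .
qed

text \<open>The form at \<open>x\<close> equals the form of \<open>\<Theta>\<close> at
  \<open>transpose_mat G *\<^sub>v x\<close>. That vector may be zero for a nonzero
  \<open>x\<close>, hence only semidefiniteness is claimed.\<close>

lemma psd_mat_congruence:
  assumes "pd_mat k \<Theta>" and G: "G \<in> carrier_mat s k"
  shows "psd_mat s (G * \<Theta> * transpose_mat G)"
proof -
  have \<Theta>: "\<Theta> \<in> carrier_mat k k" "transpose_mat \<Theta> = \<Theta>"
    using assms(1) unfolding pd_mat_def by auto
  have nonneg: "0 \<le> y \<bullet> (\<Theta> *\<^sub>v y)" if "y \<in> carrier_vec k" for y
  proof (cases "y = 0\<^sub>v k")
    case True
    then show ?thesis using \<Theta>(1) by simp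
  next
    case False
    then show ?thesis using assms(1) that unfolding pd_mat_def by (simp add: less_imp_le)
  qed
  have "x \<bullet> ((G * \<Theta> * transpose_mat G) *\<^sub>v x) = (transpose_mat G *\<^sub>v x) \<bullet> (\<Theta> *\<^sub>v (transpose_mat G *\<^sub>v x))"
    if x: "x \<in> carrier_vec s" for x
  proof -
    have y: "transpose_mat G *\<^sub>v x \<in> carrier_vec k" using G x by simp
    have "(G * \<Theta> * transpose_mat G) *\<^sub>v x = G *\<^sub>v (\<Theta> *\<^sub>v (transpose_mat G *\<^sub>v x))"
      using G \<Theta>(1) x y by (simp add: assoc_mult_mat_vec[of _ s k _ k] assoc_mult_mat_vec[of _ s k _ s])
    then show ?thesis
      using transpose_vec_mult_scalar[OF G, of "\<Theta> *\<^sub>v (transpose_mat G *\<^sub>v x)" x] \<Theta>(1) x y by simp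
  qed
  moreover have "transpose_mat (G * \<Theta> * transpose_mat G) = G * \<Theta> * transpose_mat G"
    using G \<Theta>
    by (subst transpose_mult[of _ s k _ s], simp_all add: mult_carrier_mat[of _ s k] transpose_mult[of _ s k _ k])
  ultimately show ?thesis
    unfolding psd_mat_def using nonneg G \<Theta> by auto
qed

text \<open>Passing from \<open>G\<close> to \<open>G * U\<close> leaves the Gram matrix unchanged
  and turns \<open>\<Theta>\<close> into the diagonal weights \<open>\<mu>\<close>, so
  \<open>det_weighted_gram_ge\<close> applies. Then \<open>ln_det_le_trace\<close> bounds the larger
  determinant.\<close>

lemma ln_det_gram_le:
  assumes \<Theta>: "pd_mat k \<Theta>" and G: "G \<in> carrier_mat s k" and "s \<le> k"
    and det: "det (G * transpose_mat G) \<noteq> 0"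
  shows "ln (det (G * transpose_mat G)) \<le> - (\<Sum>l = k - s + 1..k. ln (nth_greatest_eigenvalue l \<Theta>))
    + (\<Sum>i<s. (G * \<Theta> * transpose_mat G) $$ (i, i)) - real s"
proof -
  let ?M = "G * \<Theta> * transpose_mat G"
  obtain U \<mu> where U: "U \<in> carrier_mat k k" "transpose_mat U * U = 1\<^sub>m k"
    "\<Theta> = U * mat_diag k \<mu> * transpose_mat U"
    using real_spectral_theorem[of \<Theta> k] \<Theta> unfolding pd_mat_def by auto
  have pos: "0 < \<mu> j" if j: "j < k" for j
  proof -
    have "col U j \<noteq> 0\<^sub>v k" using orthogonal_col_norm[OF U j] by auto
    then show ?thesis
      using \<Theta> U(1) j unfolding rayleigh_quotient_col[OF U j, symmetric] pd_mat_def by auto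
  qed
  obtain c where c: "0 < c" "(\<Sum>l = k - s + 1..k. ln (nth_greatest_eigenvalue l \<Theta>)) = ln c"
    "\<And>T. T \<subseteq> {0..<k} \<Longrightarrow> card T = s \<Longrightarrow> c \<le> prod \<mu> T"
    using sum_nth_greatest_eigenvalue[OF U pos \<open>s \<le> k\<close>] by metis
  have GU: "G * U \<in> carrier_mat s k" using G U by simp
  have t: "transpose_mat (G * U) = transpose_mat U * transpose_mat G"
    using G U(1) by (rule transpose_mult)
  have "G * U * transpose_mat (G * U) = G * ((U * transpose_mat U) * transpose_mat G)"
    unfolding t using G U(1)
    by (simp add: assoc_mult_mat[of _ s k _ k _ s] assoc_mult_mat[of _ k k _ k _ s])
  then have gram: "G * U * transpose_mat (G * U) = G * transpose_mat G"
    using G by (simp add: orthogonal_mult_transpose[OF U])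
  have M: "G * U * mat_diag k \<mu> * transpose_mat (G * U) = ?M"
    unfolding t U(3) using G U(1)
    by (simp add: assoc_mult_mat[of _ s k _ k _ s] assoc_mult_mat[of _ k k _ k _ s]
        assoc_mult_mat[of _ s k _ k _ k] assoc_mult_mat[of _ k k _ k _ k]
        mult_carrier_mat[of _ s k] mult_carrier_mat[of _ k k])
  have le: "c * det (G * transpose_mat G) \<le> det ?M"
    using det_weighted_gram_ge[OF GU c(3)] unfolding gram M .
  have gpos: "0 < det (G * transpose_mat G)" using det_gram_nonneg[OF G] det by simp
  then have cpos: "0 < c * det (G * transpose_mat G)" using c(1) by simp
  have "ln c + ln (det (G * transpose_mat G)) = ln (c * det (G * transpose_mat G))"
    using c(1) gpos by (simp add: ln_mult)
  also have "\<dots> \<le> ln (det ?M)" using le cpos by simp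
  also have "\<dots> \<le> (\<Sum>i<s. ?M $$ (i, i)) - real s"
    using le cpos by (intro ln_det_le_trace psd_mat_congruence[OF \<Theta> G]) auto
  finally show ?thesis using c(2) by simp
qed

subsection \<open>Weak duality\<close>

lemma submatrix_mult:
  assumes "A \<in> carrier_mat nr n" and "B \<in> carrier_mat n nc"
  shows "submatrix (A * B) I J = submatrix A I UNIV * submatrix B UNIV J"
proof (rule eq_matI)
  fix i j assume "i < dim_row (submatrix A I UNIV * submatrix B UNIV J)"
    "j < dim_col (submatrix A I UNIV * submatrix B UNIV J)"
  then have ij: "i < card {i. i < nr \<and> i \<in> I}" "j < card {j. j < nc \<and> j \<in> J}"
    using assms by (auto simp: dim_submatrix)
  have p: "pick I i < nr" "pick J j < nc" using pick_le ij by auto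
  have "submatrix (A * B) I J $$ (i, j) = (\<Sum>l = 0..<n. A $$ (pick I i, l) * B $$ (l, pick J j))"
    using assms ij p by (subst submatrix_index) (auto simp: scalar_prod_def)
  then show "submatrix (A * B) I J $$ (i, j) = (submatrix A I UNIV * submatrix B UNIV J) $$ (i, j)"
    using assms ij p by (simp add: scalar_prod_def submatrix_def pick_UNIV)
qed (use assms in \<open>auto simp: dim_submatrix\<close>)

lemma submatrix_transpose: "submatrix (transpose_mat A) I J = transpose_mat (submatrix A J I)"
proof (rule eq_matI)
  fix i j assume "i < dim_row (transpose_mat (submatrix A J I))" "j < dim_col (transpose_mat (submatrix A J I))"
  then have ij: "i < card {i. i < dim_col A \<and> i \<in> I}" "j < card {j. j < dim_row A \<and> j \<in> J}"
    by (auto simp: dim_submatrix)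
  then have "pick I i < dim_col A" "pick J j < dim_row A" using pick_le by auto
  with ij show "submatrix (transpose_mat A) I J $$ (i, j) = transpose_mat (submatrix A J I) $$ (i, j)"
    by (simp add: submatrix_def)
qed (auto simp: dim_submatrix)

lemma submatrix_UNIV: "submatrix A UNIV UNIV = A"
  by (rule eq_matI) (auto simp: submatrix_def pick_UNIV)

lemma bij_betw_pick:
  assumes "finite S"
  shows "bij_betw (pick S) {..<card S} S"
proof -
  have inj: "inj_on (pick S) {..<card S}"
    by (rule linorder_inj_onI) (auto dest: pick_mono_le)
  moreover have "pick S ` {..<card S} \<subseteq> S" using pick_in_set_le by auto
  ultimately have "pick S ` {..<card S} = S"
    by (intro card_subset_eq assms) (auto simp: card_image)
  with inj show ?thesis by (simp add: bij_betw_def)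
qed

lemma trace_submatrix:
  assumes "S \<subseteq> {..<n}" and "M \<in> carrier_mat n n"
  shows "(\<Sum>i<card S. submatrix M S S $$ (i, i)) = (\<Sum>j\<in>S. M $$ (j, j))"
proof -
  have S: "{i. i < n \<and> i \<in> S} = S" using assms(1) by auto
  have "(\<Sum>i<card S. submatrix M S S $$ (i, i)) = (\<Sum>i<card S. M $$ (pick S i, pick S i))"
    using assms(2) by (intro sum.cong) (auto simp: submatrix_def S)
  also have "\<dots> = (\<Sum>j\<in>S. M $$ (j, j))"
    using assms(1) finite_subset by (intro sum.reindex_bij_betw bij_betw_pick) blast
  finally show ?thesis .
qed

lemma CMESP_feasible_support:
  assumes "CMESP_feasible n s A b x"
  shows "support_vec x \<subseteq> {..<n}" "card (support_vec x) = s"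
    "(\<Sum>j\<in>support_vec x. g j) = (\<Sum>j<n. g j * x $ j)"
proof -
  have x: "dim_vec x = n" "\<And>i. i < n \<Longrightarrow> x $ i \<in> {0, 1}" "ones_vec n \<bullet> x = real s"
    using assms by (auto simp: CMESP_feasible_def)
  show sub: "support_vec x \<subseteq> {..<n}" using x(1) by (auto simp: support_vec_def)
  have sum: "(\<Sum>j\<in>support_vec x. h j) = (\<Sum>j<n. h j * x $ j)" for h :: "nat \<Rightarrow> real"
  proof -
    have "(\<Sum>j\<in>support_vec x. h j) = (\<Sum>j\<in>support_vec x. h j * x $ j)"
      using x(1,2) by (intro sum.cong) (force simp: support_vec_def)+
    also have "\<dots> = (\<Sum>j<n. h j * x $ j)"
      using x(1) by (intro sum.mono_neutral_left sub) (auto simp: support_vec_def)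
    finally show ?thesis .
  qed
  show "(\<Sum>j\<in>support_vec x. g j) = (\<Sum>j<n. g j * x $ j)" by (rule sum)
  \<comment> \<open>The case \<open>h = 1\<close> of the sum formula, in which the right-hand side
    is the cardinality constraint.\<close>
  have "real (card (support_vec x)) = ones_vec n \<bullet> x"
    using sum[of "\<lambda>_. 1"] x(1) by (simp add: scalar_prod_def ones_vec_def atLeast0LessThan)
  then show "card (support_vec x) = s" using x(3) by simp
qed

text \<open>Keeping the terms with \<open>\<upsilon>\<close> and \<open>\<nu>\<close>, which plain
  weak duality would drop as nonnegative, is what makes the bound usable for fixing single
  variables.\<close>

lemma DFact_weak_duality_gap:
  assumes F: "F \<in> carrier_mat n k" and A: "A \<in> carrier_mat m n" and b: "b \<in> carrier_vec m"
    and "s \<le> k"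
    and x: "CMESP_feasible n s A b x" and dual: "DFact_feasible n k m F A \<Theta> \<upsilon> \<nu> \<pi> \<tau>"
    and C: "C = submatrix (F * transpose_mat F) (support_vec x) (support_vec x)" and det: "det C \<noteq> 0"
  shows
    "ln (det C) + (\<Sum>j<n. \<upsilon> $ j * x $ j + \<nu> $ j * (1 - x $ j)) \<le> DFact_objective n k s b \<Theta> \<nu> \<pi> \<tau>"
proof -
  let ?S = "support_vec x"
  let ?M = "F * \<Theta> * transpose_mat F"
  note supp = CMESP_feasible_support[OF x]
  have xc: "x \<in> carrier_vec n" "ones_vec n \<bullet> x = real s" "A *\<^sub>v x \<le> b"
    using x by (auto simp: CMESP_feasible_def)
  have \<Theta>: "pd_mat k \<Theta>" and \<Theta>c: "\<Theta> \<in> carrier_mat k k"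
    and \<upsilon>: "\<upsilon> \<in> carrier_vec n" and \<nu>: "\<nu> \<in> carrier_vec n" and \<pi>: "\<pi> \<in> carrier_vec m"
    and eq: "diag_vec ?M + \<upsilon> - \<nu> - transpose_mat A *\<^sub>v \<pi> - \<tau> \<cdot>\<^sub>v ones_vec n = 0\<^sub>v n"
    and \<pi>0: "0\<^sub>v m \<le> \<pi>"
    using dual unfolding DFact_feasible_def pd_mat_def by blast+
  \<comment> \<open>The rows of \<open>F\<close> in the support, with all \<open>k\<close> columns
    kept, so that both \<open>C\<close> and the submatrix of \<open>?M\<close> factor through
    \<open>G\<close>.\<close>
  define G where "G = submatrix F ?S UNIV"
  have "{i. i < n \<and> i \<in> ?S} = ?S" using supp(1) by auto
  then have G: "G \<in> carrier_mat s k"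
    using F supp(2) by (auto simp: G_def submatrix_def)
  have CG: "C = G * transpose_mat G"
    unfolding C G_def submatrix_transpose[symmetric] using F by (intro submatrix_mult) auto
  have "submatrix ?M ?S ?S = submatrix (F * \<Theta>) ?S UNIV * submatrix (transpose_mat F) UNIV ?S"
    using F \<Theta>c by (intro submatrix_mult[of _ n k _ n]) auto
  also have "submatrix (F * \<Theta>) ?S UNIV = G * \<Theta>"
    using submatrix_mult[OF F \<Theta>c, of ?S UNIV] by (simp add: G_def submatrix_UNIV)
  finally have "submatrix ?M ?S ?S = G * \<Theta> * transpose_mat G"
    by (simp add: G_def submatrix_transpose)
  then have trace: "(\<Sum>i<s. (G * \<Theta> * transpose_mat G) $$ (i, i)) = (\<Sum>j<n. ?M $$ (j, j) * x $ j)"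
    using trace_submatrix[OF supp(1), of ?M] F \<Theta>c by (simp add: supp(2,3))
  have M: "?M $$ (j, j) = \<nu> $ j - \<upsilon> $ j + (transpose_mat A *\<^sub>v \<pi>) $ j + \<tau>" if j: "j < n" for j
  proof -
    have "diag_vec ?M $ j = ?M $$ (j, j)" "dim_vec (diag_vec ?M) = n"
      using j F \<Theta>c by (simp_all add: diag_vec_def diag_mat_def vec_of_list_index)
    then show ?thesis
      using arg_cong[OF eq, of "\<lambda>w. w $ j"] j \<upsilon> \<nu> \<pi> A by (simp add: ones_vec_def del: index_mult_mat_vec)
  qed
  have "(\<Sum>j<n. ?M $$ (j, j) * x $ j) =
      (\<Sum>j<n. \<nu> $ j * x $ j - \<upsilon> $ j * x $ j + (transpose_mat A *\<^sub>v \<pi>) $ j * x $ j + \<tau> * x $ j)"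
    by (intro sum.cong refl) (simp add: M algebra_simps)
  also have "\<dots> = (\<Sum>j<n. \<nu> $ j * x $ j - \<upsilon> $ j * x $ j) + (transpose_mat A *\<^sub>v \<pi>) \<bullet> x + \<tau> * (ones_vec n \<bullet> x)"
    using xc(1) by (simp add: sum.distrib sum_distrib_left scalar_prod_def ones_vec_def atLeast0LessThan)
  also have "(transpose_mat A *\<^sub>v \<pi>) \<bullet> x = \<pi> \<bullet> (A *\<^sub>v x)"
    using transpose_vec_mult_scalar[OF A xc(1) \<pi>] .
  \<comment> \<open>Here the constraints \<open>A *\<^sub>v x \<le> b\<close> enter, weighted by the
    nonnegative multipliers \<open>\<pi>\<close>.\<close>
  also have "\<pi> \<bullet> (A *\<^sub>v x) \<le> \<pi> \<bullet> b"
    using xc(3) \<pi>0 \<pi> b unfolding less_eq_vec_def scalar_prod_def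
    by (auto intro!: sum_mono mult_left_mono)
  finally have le: "(\<Sum>j<n. ?M $$ (j, j) * x $ j) \<le>
      (\<Sum>j<n. \<nu> $ j * x $ j - \<upsilon> $ j * x $ j) + \<pi> \<bullet> b + \<tau> * real s"
    using xc(2) by simp
  \<comment> \<open>The gap terms are what remains of \<open>\<nu> \<bullet> ones_vec n\<close>
    after subtracting the part that the trace bound consumes.\<close>
  have "(\<Sum>j<n. \<upsilon> $ j * x $ j + \<nu> $ j * (1 - x $ j)) + (\<Sum>j<n. \<nu> $ j * x $ j - \<upsilon> $ j * x $ j) = \<nu> \<bullet> ones_vec n"
    by (simp add: sum.distrib[symmetric] scalar_prod_def ones_vec_def atLeast0LessThan algebra_simps)
  then show "ln (det C) + (\<Sum>j<n. \<upsilon> $ j * x $ j + \<nu> $ j * (1 - x $ j)) \<le> DFact_objective n k s b \<Theta> \<nu> \<pi> \<tau>"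
    using ln_det_gram_le[OF \<Theta> G \<open>s \<le> k\<close>] det le
    unfolding DFact_objective_def CG trace by simp
qed

theorem theorem2p7:
  fixes n s r k m :: nat
    and C F A \<Theta> :: "real mat"
    and b \<upsilon> \<nu> \<pi> x_hat :: "real vec"
    and \<tau> \<zeta> :: real
    and LB :: ereal
  assumes "n > 1" and "0 < s" and "s < n"
    and "psd_mat n C"
    and "vec_space.rank n C = r" and "s \<le> r"
    and "A \<in> carrier_mat m n" and "b \<in> carrier_vec m"
    and "F \<in> carrier_mat n k" and "r \<le> k" and "k \<le> n"
    and "C = F * transpose_mat F"
    and "CMESP_feasible n s A b x_hat"
    and "LB = CMESP_objective C x_hat"
    and "DFact_feasible n k m F A \<Theta> \<upsilon> \<nu> \<pi> \<tau>"
    and "\<zeta> = DFact_objective n k s b \<Theta> \<nu> \<pi> \<tau>"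
  shows "\<forall>x. CMESP_optimal n s C A b x \<longrightarrow>
    (\<forall>j \<in> {..<n}. ereal \<zeta> - LB < ereal (\<upsilon> $ j) \<longrightarrow> x $ j = 0) \<and>
    (\<forall>j \<in> {..<n}. ereal \<zeta> - LB < ereal (\<nu> $ j) \<longrightarrow> x $ j = 1)"
proof (intro allI impI)
  fix x assume opt: "CMESP_optimal n s C A b x"
  then have feas: "CMESP_feasible n s A b x" and LB: "LB \<le> CMESP_objective C x"
    using assms(13,14) by (auto simp: CMESP_optimal_def)
  have x01: "x $ j = 0 \<or> x $ j = 1" if "j < n" for j
    using feas that by (auto simp: CMESP_feasible_def)
  have nonneg: "0 \<le> \<upsilon> $ j" "0 \<le> \<nu> $ j" if "j < n" for j
  proof -
    have "0\<^sub>v n \<le> \<upsilon>" "\<upsilon> \<in> carrier_vec n" "0\<^sub>v n \<le> \<nu>" "\<nu> \<in> carrier_vec n"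
      using assms(15) unfolding DFact_feasible_def by blast+
    then show "0 \<le> \<upsilon> $ j" "0 \<le> \<nu> $ j" using that by (auto simp: less_eq_vec_def)
  qed
  let ?g = "\<lambda>j. \<upsilon> $ j * x $ j + \<nu> $ j * (1 - x $ j)"
  have g0: "0 \<le> ?g j" if "j < n" for j
    using x01[OF that] nonneg[OF that] by auto
  \<comment> \<open>\<open>?g j\<close> is \<open>\<upsilon> $ j\<close> if \<open>x $ j = 1\<close>
    and \<open>\<nu> $ j\<close> if \<open>x $ j = 0\<close>. Taking this value for \<open>a\<close>
    is therefore contradictory, which excludes the unwanted value of \<open>x $ j\<close>.\<close>
  have gap: "?g j < a" if j: "j < n" and a: "ereal \<zeta> - LB < ereal a" for j a
  proof -
    let ?C = "submatrix C (support_vec x) (support_vec x)"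
    \<comment> \<open>A bound of minus infinity would make the difference infinite and the
      assumption on \<open>a\<close> false. Hence the optimal submatrix is nonsingular and its
      \<open>ldet\<close> is a real logarithm.\<close>
    have "LB \<noteq> - \<infinity>" using a by auto
    then have det: "det ?C \<noteq> 0"
      using LB by (auto simp: CMESP_objective_def ldet_def split: if_splits)
    have "s \<le> k" using assms(6,10) by simp
    note duality = DFact_weak_duality_gap[OF assms(9,7,8) this feas assms(15), of ?C]
    \<comment> \<open>All summands are nonnegative, so a single one is bounded by the whole duality
      gap.\<close>
    have "?g j \<le> (\<Sum>i<n. ?g i)"
      using j g0 by (intro member_le_sum) auto
    also have "\<dots> \<le> \<zeta> - ln (det ?C)"
      using duality det unfolding assms(12,16) by simp
    finally have "ereal (?g j) \<le> ereal \<zeta> - ldet ?C"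
      using det by (simp add: ldet_def)
    also have "\<dots> \<le> ereal \<zeta> - LB"
      using LB unfolding CMESP_objective_def by (intro ereal_minus_mono) auto
    also have "\<dots> < ereal a" by fact
    finally show ?thesis by simp
  qed
  show "(\<forall>j \<in> {..<n}. ereal \<zeta> - LB < ereal (\<upsilon> $ j) \<longrightarrow> x $ j = 0) \<and>
    (\<forall>j \<in> {..<n}. ereal \<zeta> - LB < ereal (\<nu> $ j) \<longrightarrow> x $ j = 1)"
  proof (intro conjI ballI impI)
    fix j assume "j \<in> {..<n}" and "ereal \<zeta> - LB < ereal (\<upsilon> $ j)"
    then show "x $ j = 0" using gap[of j "\<upsilon> $ j"] x01[of j] by auto
  next
    fix j assume "j \<in> {..<n}" and "ereal \<zeta> - LB < ereal (\<nu> $ j)"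
    then show "x $ j = 1" using gap[of j "\<nu> $ j"] x01[of j] by auto
  qed
qed

end
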